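(* Let $q:\Theta\to[0,\infty)$ be an integrable function with normalizing constant $c_q$, so that $q_\ast=q/c_q$ is a probability density on $\Theta$, and consider the linearly contaminated prior density $$\pi_\epsilon(\theta)=\frac{1-\epsilon}{1-\epsilon+\epsilon c_q}\pi(\theta)+\frac{\epsilon c_q}{1-\epsilon+\epsilon c_q}\frac{q(\theta)}{c_q}.$$ Let $RB_\epsilon(\theta\,|\,T(x))=f_{\theta,T}(T(x))/m_{T,\epsilon}(T(x))$ be the relative belief ratio at $\theta$ based on $\pi_\epsilon$. Then, under this linear contamination of the prior, $$\left.\frac{\partial\log RB_\epsilon(\theta\,|\,T(x))}{\partial\epsilon}\right\vert_{\epsilon=0}=c_q\left(1-\frac{m_T^{(q_\ast)}(T(x))}{m_T(T(x))}\right),$$ which satisfies $$E_{m_T}\left(\left.\frac{\partial\log RB_\epsilon(\theta\,|\,T(x))}{\partial\epsilon}\right\vert_{\epsilon=0}\right)=0,$$ where $E_{m_T}$ denotes expectation when $T(x)$ is distributed according to the density $m_T$.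
   Context: $T$ is a minimal sufficient statistic, with values in $\mathcal T$, for a statistical model with parameter space $\Theta$, and $x$ is the observed data; $f_{\theta,T}$ is the sampling density of $T$ under $\theta$. The prior $\Pi$ on $\Theta$ has density $\pi$, and $\theta$ is the point at which sensitivity to the prior is assessed, with $\Pi(\{\theta\})=\pi(\theta)>0$; the result also applies in the continuous case, where the relative belief ratio is the ratio of the posterior density to the prior density at $\theta$. The prior predictive density $m_T$ of $T$ is the average of $f_{\theta,T}$ over $\theta$ with respect to the prior density $\pi$; $m_T^{(q_\ast)}$ is the prior predictive density of $T$ obtained using the prior density $q_\ast$; and $m_{T,\epsilon}$ is the prior predictive density of $T$ obtained using $\pi_\epsilon$, namely $$m_{T,\epsilon}(T(x))=\frac{1-\epsilon}{1-\epsilon+\epsilon c_q}m_T(T(x))+\frac{\epsilon c_q}{1-\epsilon+\epsilon c_q}m_T^{(q_\ast)}(T(x)).$$ The relative belief ratio at $\theta$ based on $\pi$ is $RB(\theta\,|\,T(x))=f_{\theta,T}(T(x))/m_T(T(x))$.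
   Formalization: The zero-expectation claim additionally assumes that the prior predictive of q_* is absolutely continuous w.r.t. m_T (it is false otherwise); for the literal derivative also f_θ,T>0 m_T-a.e. The pointwise formula is stated where f_θ,T and m_T are positive and the q-predictive is finite. *)

theory Defs
  imports "HOL-Probability.Probability"
begin

text \<open>
  A statistical model on the sample space \<open>X\<close> is a family \<open>P\<close> of probability measures on \<open>X\<close>.
  A measure \<open>\<Theta>\<close> carries both the parameter space, as \<open>space \<Theta>\<close>, and the support measure with
  respect to which prior densities are taken (counting measure in the discrete case).
\<close>

definition sufficient_statistic ::
  "'p set \<Rightarrow> ('p \<Rightarrow> 'x measure) \<Rightarrow> 'x measure \<Rightarrow> 's measure \<Rightarrow> ('x \<Rightarrow> 's) \<Rightarrow> bool"
where
  "sufficient_statistic \<Omega> P X N S \<longleftrightarrow>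
     S \<in> measurable X N \<and>
     (\<forall>A\<in>sets X. \<exists>g\<in>borel_measurable N. \<forall>\<theta>\<in>\<Omega>.
        AE x in P \<theta>. real_cond_exp (P \<theta>) (vimage_algebra (space X) S N) (indicator A) x = g (S x))"

text \<open>
  Competing statistics \<open>S\<close> are taken with values in the type of the sample space. Nothing is lost:
  a statistic with values elsewhere may be replaced by the map sending a sample point to a chosen
  representative of its fibre, with the \<open>\<sigma>\<close>-algebra of all sets whose preimage lies in the
  \<open>\<sigma>\<close>-algebra generated by the original statistic.
\<close>

definition minimal_sufficient_statistic ::
  "'p set \<Rightarrow> ('p \<Rightarrow> 'x measure) \<Rightarrow> 'x measure \<Rightarrow> 't measure \<Rightarrow> ('x \<Rightarrow> 't) \<Rightarrow> bool"
where
  "minimal_sufficient_statistic \<Omega> P X L T \<longleftrightarrow>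
     sufficient_statistic \<Omega> P X L T \<and>
     (\<forall>(N :: 'x measure) S. sufficient_statistic \<Omega> P X N S \<longrightarrow>
        (\<exists>h\<in>measurable N L. \<forall>\<theta>\<in>\<Omega>. AE x in P \<theta>. T x = h (S x)))"

definition prob_density :: "'p measure \<Rightarrow> ('p \<Rightarrow> real) \<Rightarrow> bool" where
  "prob_density \<Theta> p \<longleftrightarrow>
     (\<forall>\<theta>\<in>space \<Theta>. 0 \<le> p \<theta>) \<and> integrable \<Theta> p \<and> (\<integral>\<theta>. p \<theta> \<partial>\<Theta>) = 1"

definition norm_const :: "'p measure \<Rightarrow> ('p \<Rightarrow> real) \<Rightarrow> real" where
  "norm_const \<Theta> q = (\<integral>\<theta>. q \<theta> \<partial>\<Theta>)"

definition normalized :: "'p measure \<Rightarrow> ('p \<Rightarrow> real) \<Rightarrow> 'p \<Rightarrow> real" where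
  "normalized \<Theta> q \<theta> = q \<theta> / norm_const \<Theta> q"

definition contaminated_prior ::
  "'p measure \<Rightarrow> ('p \<Rightarrow> real) \<Rightarrow> ('p \<Rightarrow> real) \<Rightarrow> real \<Rightarrow> 'p \<Rightarrow> real"
where
  "contaminated_prior \<Theta> \<pi> q \<epsilon> \<theta> =
     (1 - \<epsilon>) / (1 - \<epsilon> + \<epsilon> * norm_const \<Theta> q) * \<pi> \<theta>
     + \<epsilon> * norm_const \<Theta> q / (1 - \<epsilon> + \<epsilon> * norm_const \<Theta> q) * normalized \<Theta> q \<theta>"

text \<open>
  In the next three definitions \<open>f \<theta> t\<close> is the sampling density of the statistic at \<open>t\<close> under
  \<open>\<theta>\<close>, and \<open>p\<close> is a prior density.
\<close>

definition prior_pred :: "'p measure \<Rightarrow> ('p \<Rightarrow> 't \<Rightarrow> real) \<Rightarrow> ('p \<Rightarrow> real) \<Rightarrow> 't \<Rightarrow> real" where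
  "prior_pred \<Theta> f p t = (\<integral>\<theta>. f \<theta> t * p \<theta> \<partial>\<Theta>)"

definition prior_pred_measure ::
  "'p measure \<Rightarrow> 't measure \<Rightarrow> ('p \<Rightarrow> 't \<Rightarrow> real) \<Rightarrow> ('p \<Rightarrow> real) \<Rightarrow> 't measure"
where
  "prior_pred_measure \<Theta> L f p = density L (\<lambda>t. ennreal (prior_pred \<Theta> f p t))"

definition rel_belief ::
  "'p measure \<Rightarrow> ('p \<Rightarrow> 't \<Rightarrow> real) \<Rightarrow> ('p \<Rightarrow> real) \<Rightarrow> 'p \<Rightarrow> 't \<Rightarrow> real"
where
  "rel_belief \<Theta> f p \<theta> t = f \<theta> t / prior_pred \<Theta> f p t"

end

theory Submission
  imports Defs "HOL-Real_Asymp.Real_Asymp"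
begin

text \<open>
  At a point \<open>t\<close> where the relevant integrals exist, the contaminated prior predictive is a linear
  fractional function of \<open>\<epsilon>\<close>, so the derivative of the log relative belief ratio is elementary.
  Its expectation vanishes because absolute continuity makes the ratio of the two prior predictive
  densities a Radon-Nikodym derivative between probability measures, with expectation \<open>1\<close>.
\<close>

section \<open>Values of \<open>deriv\<close> where no derivative exists\<close>

text \<open>\<open>deriv\<close> picks a number by Hilbert choice. Without a derivative the
  predicate is everywhere false, so the pick is one fixed number, the same for all functions and
  points. This uniformity later makes the exceptional values measurable in \<open>t\<close>.\<close>

lemma deriv_not_differentiable:
  assumes "\<not> f field_differentiable (at x)"
  shows "deriv f x = (SOME D. False)"
  using assms by (auto simp: deriv_def field_differentiable_def)

text \<open>The hypothesis says nothing about \<open>a\<close> itself. Either \<open>F\<close>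
  vanishes on a full neighbourhood, or it jumps at \<open>a\<close> and cannot be differentiable
  there.\<close>

lemma deriv_eventually_zero:
  fixes F :: "real \<Rightarrow> real"
  assumes ev: "eventually (\<lambda>x. F x = 0) (at a)"
  shows "deriv F a = (if F a = 0 then 0 else (SOME D. False))"
proof (cases "F a = 0")
  case True
  have "eventually (\<lambda>x. F x = 0) (nhds a)"
    using ev True by (simp add: eventually_nhds_conv_at)
  then have "deriv F a = deriv (\<lambda>_. 0) a"
    by (intro deriv_cong_ev) auto
  with True show ?thesis by simp
next
  case False
  have "\<not> F field_differentiable (at a)"
  proof
    assume "F field_differentiable (at a)"
    then have "(F \<longlongrightarrow> F a) (at a)"
      using field_differentiable_imp_continuous_at isCont_def by blast
    moreover have "(F \<longlongrightarrow> 0) (at a)"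
      using ev by (simp add: tendsto_eventually)
    ultimately show False using False LIM_unique by blast
  qed
  with False show ?thesis by (simp add: deriv_not_differentiable)
qed

section \<open>The contaminated integral as a function of \<epsilon>\<close>

text \<open>With \<open>g\<close> = likelihood times \<pi>, \<open>h\<close> = likelihood times the
  unnormalized \<open>q\<close>, and \<open>c\<close> the normalizing constant, this is the
  contaminated prior predictive density. The mixture stays under a single integral because
  \<open>g\<close> and \<open>h\<close> need not be integrable separately.\<close>

definition mixture_int :: "'p measure \<Rightarrow> real \<Rightarrow> ('p \<Rightarrow> real) \<Rightarrow> ('p \<Rightarrow> real) \<Rightarrow> real \<Rightarrow> real" where
  "mixture_int M c g h \<epsilon> = (\<integral>\<omega>. ((1 - \<epsilon>) * g \<omega> + \<epsilon> * h \<omega>) / (1 - \<epsilon> + \<epsilon> * c) \<partial>M)"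

lemma mixture_int_0 [simp]: "mixture_int M c g h 0 = (\<integral>\<omega>. g \<omega> \<partial>M)"
  by (simp add: mixture_int_def)

lemma mixture_int_eq:
  assumes "integrable M g" "integrable M h"
  shows "mixture_int M c g h \<epsilon> =
    ((1 - \<epsilon>) * (\<integral>\<omega>. g \<omega> \<partial>M) + \<epsilon> * (\<integral>\<omega>. h \<omega> \<partial>M)) / (1 - \<epsilon> + \<epsilon> * c)"
  using assms by (simp add: mixture_int_def)

text \<open>
  If two different mixtures of \<open>g\<close> and \<open>h\<close> are integrable, so are \<open>g\<close> and \<open>h\<close>; otherwise the
  Bochner integral takes its junk value \<open>0\<close> for all but at most one \<open>\<epsilon>\<close>.
\<close>

lemma mixture_int_eventually_zero:
  assumes "\<not> (integrable M g \<and> integrable M h)"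
  shows "eventually (\<lambda>\<epsilon>. mixture_int M c g h \<epsilon> = 0) (at a)"
proof -
  let ?Z = "{\<epsilon>. mixture_int M c g h \<epsilon> \<noteq> 0}"
  have integrable_mix: "integrable M (\<lambda>\<omega>. (1 - x) * g \<omega> + x * h \<omega>)" if "x \<in> ?Z" for x
  proof -
    \<comment> \<open>A vanishing denominator would make the integrand 0, since division by zero
      yields 0.\<close>
    have D: "1 - x + x * c \<noteq> 0"
      using that by (auto simp: mixture_int_def)
    have "integrable M (\<lambda>\<omega>. ((1 - x) * g \<omega> + x * h \<omega>) / (1 - x + x * c))"
      using that not_integrable_integral_eq by (fastforce simp: mixture_int_def)
    from integrable_mult_left[OF this, of "1 - x + x * c"] D show ?thesis
      by simp
  qed
  have uniq: "x = y" if xy: "x \<in> ?Z" "y \<in> ?Z" for x y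
  proof (rule ccontr)
    assume ne: "x \<noteq> y"
    let ?u = "\<lambda>x \<omega>. (1 - x) * g \<omega> + x * h \<omega>"
    note ux = integrable_mix[OF xy(1)] and uy = integrable_mix[OF xy(2)]
    \<comment> \<open>The mixtures at \<open>x\<close> and \<open>y\<close> form a linear system in
      \<open>g\<close> and \<open>h\<close> with determinant \<open>y - x\<close>; this and the next
      combination solve it.\<close>
    have "integrable M (\<lambda>\<omega>. (y * ?u x \<omega> - x * ?u y \<omega>) / (y - x))"
      by (rule integrable_divide, rule Bochner_Integration.integrable_diff;
          rule integrable_mult_right, rule ux uy)
    moreover have "integrable M (\<lambda>\<omega>. ((1 - x) * ?u y \<omega> - (1 - y) * ?u x \<omega>) / (y - x))"
      by (rule integrable_divide, rule Bochner_Integration.integrable_diff;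
          rule integrable_mult_right, rule ux uy)
    moreover have "(\<lambda>\<omega>. (y * ?u x \<omega> - x * ?u y \<omega>) / (y - x)) = g"
      using ne by (auto simp: fun_eq_iff field_simps)
    moreover have "(\<lambda>\<omega>. ((1 - x) * ?u y \<omega> - (1 - y) * ?u x \<omega>) / (y - x)) = h"
      using ne by (auto simp: fun_eq_iff field_simps)
    ultimately show False using assms by simp
  qed
  show ?thesis
  proof (cases "?Z = {}")
    case True
    then show ?thesis by auto
  next
    case False
    then obtain z where z: "z \<in> ?Z" by auto
    \<comment> \<open>The filter \<open>at a\<close> is punctured, so this covers
      \<open>z = a\<close> as well.\<close>
    have "eventually (\<lambda>\<epsilon>. \<epsilon> \<noteq> z) (at a)"
      by (rule eventually_neq_at_within)
    then show ?thesis
      by eventually_elim (use uniq[OF _ z] in blast)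
  qed
qed

text \<open>With \<open>a\<close> and \<open>b\<close> the integrals of \<open>g\<close> and
  \<open>h\<close>, the logarithmic derivative at 0 is \<open>(c - 1) - (b - a) / a\<close>: the
  first term comes from the normalizing denominator, the second from the mixture.\<close>

lemma has_derivative_ln_mixture:
  assumes "integrable M g" "integrable M h"
    and A: "0 < A" and pos: "0 < (\<integral>\<omega>. g \<omega> \<partial>M)"
  shows "((\<lambda>\<epsilon>. ln (A / mixture_int M c g h \<epsilon>)) has_real_derivative
      c - (\<integral>\<omega>. h \<omega> \<partial>M) / (\<integral>\<omega>. g \<omega> \<partial>M)) (at 0)"
proof -
  define a b where "a = (\<integral>\<omega>. g \<omega> \<partial>M)" and "b = (\<integral>\<omega>. h \<omega> \<partial>M)"
  have a: "0 < a" using pos by (simp add: a_def)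
  let ?R = "\<lambda>\<epsilon>. A * (1 - \<epsilon> + \<epsilon> * c) / ((1 - \<epsilon>) * a + \<epsilon> * b)"
  have "(?R has_real_derivative A * (c * a - b) / (a * a)) (at 0)"
    using a by (auto intro!: derivative_eq_intros simp: algebra_simps)
  then have "((\<lambda>\<epsilon>. ln (?R \<epsilon>)) has_real_derivative 1 / ?R 0 * (A * (c * a - b) / (a * a))) (at 0)"
    by (rule DERIV_chain2[rotated]) (rule DERIV_ln_divide, use A a in simp)
  moreover have "1 / ?R 0 * (A * (c * a - b) / (a * a)) = c - b / a"
    using A a by (simp add: field_simps)
  ultimately have "((\<lambda>\<epsilon>. ln (A / (((1 - \<epsilon>) * a + \<epsilon> * b) / (1 - \<epsilon> + \<epsilon> * c))))
      has_real_derivative c - b / a) (at 0)"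
    by simp
  then show ?thesis
    by (simp only: mixture_int_eq[OF assms(1,2)] a_def b_def)
qed

text \<open>The mixture integral tends to 0 as \<epsilon> does, so the logarithm tends to infinity
  from the right and is discontinuous at 0.\<close>

lemma deriv_ln_mixture_pole:
  assumes "integrable M g" "integrable M h"
    and A: "0 < A" and g0: "(\<integral>\<omega>. g \<omega> \<partial>M) = 0" and h0: "0 < (\<integral>\<omega>. h \<omega> \<partial>M)"
  shows "deriv (\<lambda>\<epsilon>. ln (A / mixture_int M c g h \<epsilon>)) 0 = (SOME D. False)"
proof -
  define b where "b = (\<integral>\<omega>. h \<omega> \<partial>M)"
  let ?F = "\<lambda>\<epsilon>. ln (A / (\<epsilon> * b / (1 - \<epsilon> + \<epsilon> * c)))"
  have "b > 0" using h0 by (simp add: b_def)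
  with A have lim: "filterlim ?F at_top (at_right 0)"
    by real_asymp
  have "\<not> ?F field_differentiable (at 0)"
  proof
    assume "?F field_differentiable (at 0)"
    then have "(?F \<longlongrightarrow> ?F 0) (at 0)"
      using field_differentiable_imp_continuous_at isCont_def by blast
    then have "(?F \<longlongrightarrow> ?F 0) (at_right 0)"
      by (rule filterlim_mono) (auto intro: at_le)
    with filterlim_at_top_imp_at_infinity[OF lim] show False
      using not_tendsto_and_filterlim_at_infinity[of "at_right (0::real)"] by force
  qed
  moreover have "(\<lambda>\<epsilon>. ln (A / mixture_int M c g h \<epsilon>)) = ?F"
    unfolding mixture_int_eq[OF assms(1,2)] g0 b_def by simp
  ultimately show ?thesis by (simp add: deriv_not_differentiable)
qed

text \<open>
  The junk values of \<open>deriv\<close> are spelled out because integrability of the derivative requires it to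
  be measurable also on the null set of exceptional points.
\<close>

lemma deriv_ln_mixture:
  assumes "0 \<le> A" "0 \<le> (\<integral>\<omega>. g \<omega> \<partial>M)" "0 \<le> (\<integral>\<omega>. h \<omega> \<partial>M)"
  shows "deriv (\<lambda>\<epsilon>. ln (A / mixture_int M c g h \<epsilon>)) 0 =
    (if integrable M g \<and> integrable M h then
       if 0 < A \<and> 0 < (\<integral>\<omega>. g \<omega> \<partial>M) then c - (\<integral>\<omega>. h \<omega> \<partial>M) / (\<integral>\<omega>. g \<omega> \<partial>M)
       else if 0 < A \<and> 0 < (\<integral>\<omega>. h \<omega> \<partial>M) then (SOME D. False) else 0
     else if ln (A / (\<integral>\<omega>. g \<omega> \<partial>M)) = 0 then 0 else (SOME D. False))"
proof (cases "integrable M g \<and> integrable M h")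
  case True
  then have int: "integrable M g" "integrable M h" by auto
  consider "0 < A" "0 < (\<integral>\<omega>. g \<omega> \<partial>M)"
    | "0 < A" "(\<integral>\<omega>. g \<omega> \<partial>M) = 0" "0 < (\<integral>\<omega>. h \<omega> \<partial>M)"
    | "A = 0 \<or> (\<integral>\<omega>. g \<omega> \<partial>M) = 0 \<and> (\<integral>\<omega>. h \<omega> \<partial>M) = 0"
    using assms by linarith
  then show ?thesis
  proof cases
    case 1
    with int show ?thesis by (simp add: DERIV_imp_deriv[OF has_derivative_ln_mixture])
  next
    case 2
    with int show ?thesis by (simp add: deriv_ln_mixture_pole)
  next
    case 3
    \<comment> \<open>The argument of \<open>ln\<close> is always 0, directly or through division by
      zero, and \<open>ln 0 = 0\<close>.\<close>
    then have "(\<lambda>\<epsilon>. ln (A / mixture_int M c g h \<epsilon>)) = (\<lambda>_. 0)"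
      by (auto simp: mixture_int_eq[OF int])
    with 3 int show ?thesis by auto
  qed
next
  case False
  \<comment> \<open>Only the value at \<epsilon> = 0 may differ from 0 near that point; it decides
    between the two outcomes.\<close>
  have "eventually (\<lambda>\<epsilon>. ln (A / mixture_int M c g h \<epsilon>) = 0) (at 0)"
    using mixture_int_eventually_zero[OF False, of c 0] by eventually_elim simp
  from deriv_eventually_zero[OF this] False show ?thesis by (simp only: mixture_int_0 if_False)
qed

section \<open>Integrals of densities and prior predictives\<close>

text \<open>The factor \<open>m\<close> cancels wherever it is nonzero. Absolute continuity forces
  \<open>n\<close> to vanish almost everywhere on the zero set of \<open>m\<close>, so no mass of
  \<open>n\<close> is lost there.\<close>

lemma has_bochner_integral_density_ratio:
  fixes m n :: "'t \<Rightarrow> real"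
  assumes [measurable]: "m \<in> borel_measurable L" "n \<in> borel_measurable L"
    and m0: "\<And>t. t \<in> space L \<Longrightarrow> 0 \<le> m t" and n0: "\<And>t. t \<in> space L \<Longrightarrow> 0 \<le> n t"
    and n1: "(\<integral>\<^sup>+t. ennreal (n t) \<partial>L) = 1"
    and ac: "absolutely_continuous (density L (\<lambda>t. ennreal (m t))) (density L (\<lambda>t. ennreal (n t)))"
  shows "has_bochner_integral (density L (\<lambda>t. ennreal (m t))) (\<lambda>t. n t / m t) 1"
proof -
  let ?N = "{t \<in> space L. m t = 0}"
  have "?N \<in> null_sets (density L (\<lambda>t. ennreal (m t)))"
    by (subst null_sets_density_iff) auto
  then have "?N \<in> null_sets (density L (\<lambda>t. ennreal (n t)))"
    using ac by (auto simp: absolutely_continuous_def)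
  then have "AE t in L. t \<in> ?N \<longrightarrow> ennreal (n t) = 0"
    by (subst (asm) null_sets_density_iff) auto
  then have eq: "AE t in L. n t = m t *\<^sub>R (n t / m t)"
    using AE_space by eventually_elim (use n0 in \<open>auto simp: ennreal_eq_0_iff intro: antisym\<close>)
  have "has_bochner_integral L n 1"
    using n0 n1 by (intro has_bochner_integral_nn_integral) auto
  then have "has_bochner_integral L (\<lambda>t. m t *\<^sub>R (n t / m t)) 1"
    using eq by (subst (asm) has_bochner_integral_cong_AE) auto
  then show ?thesis
    using m0 by (intro has_bochner_integral_density) auto
qed

text \<open>Measurability of the set of points with integrable integrand is needed for the case
  distinction in the formula for \<open>deriv\<close>.\<close>

lemma borel_measurable_prior_pred:
  assumes "sigma_finite_measure \<Theta>"
    and [measurable]: "(\<lambda>(\<omega>, t). f \<omega> t) \<in> borel_measurable (\<Theta> \<Otimes>\<^sub>M L)" "p \<in> borel_measurable \<Theta>"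
  shows "prior_pred \<Theta> f p \<in> borel_measurable L"
    and "Measurable.pred L (\<lambda>t. integrable \<Theta> (\<lambda>\<omega>. f \<omega> t * p \<omega>))"
proof -
  interpret sigma_finite_measure \<Theta> by fact
  \<comment> \<open>The arguments are swapped so that the variable of integration comes
    second.\<close>
  have [measurable]: "(\<lambda>(t, \<omega>). f \<omega> t * p \<omega>) \<in> borel_measurable (L \<Otimes>\<^sub>M \<Theta>)"
    by measurable
  show "prior_pred \<Theta> f p \<in> borel_measurable L"
    unfolding prior_pred_def[abs_def] by measurable
  show "Measurable.pred L (\<lambda>t. integrable \<Theta> (\<lambda>\<omega>. f \<omega> t * p \<omega>))"
    by measurable
qed

lemma prior_pred_nonneg:
  assumes "\<And>\<omega>. \<omega> \<in> space \<Theta> \<Longrightarrow> 0 \<le> f \<omega> t" "\<And>\<omega>. \<omega> \<in> space \<Theta> \<Longrightarrow> 0 \<le> p \<omega>"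
  shows "0 \<le> prior_pred \<Theta> f p t"
  using assms by (auto simp: prior_pred_def intro!: Bochner_Integration.integral_nonneg)

text \<open>By Tonelli, integrating out \<open>t\<close> first leaves the total mass of
  \<open>p\<close>. Finiteness of the double integral then makes the inner integrals finite almost
  everywhere.\<close>

lemma prior_pred_Fubini:
  assumes "sigma_finite_measure \<Theta>" "sigma_finite_measure L"
    and f [measurable]: "(\<lambda>(\<omega>, t). f \<omega> t) \<in> borel_measurable (\<Theta> \<Otimes>\<^sub>M L)"
    and f0: "\<And>\<omega> t. \<omega> \<in> space \<Theta> \<Longrightarrow> t \<in> space L \<Longrightarrow> 0 \<le> f \<omega> t"
    and f1: "\<And>\<omega>. \<omega> \<in> space \<Theta> \<Longrightarrow> (\<integral>\<^sup>+t. ennreal (f \<omega> t) \<partial>L) = 1"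
    and p: "prob_density \<Theta> p"
  shows "(\<integral>\<^sup>+t. ennreal (prior_pred \<Theta> f p t) \<partial>L) = 1"
    and "AE t in L. integrable \<Theta> (\<lambda>\<omega>. f \<omega> t * p \<omega>)"
proof -
  interpret \<Theta>: sigma_finite_measure \<Theta> by fact
  interpret L: sigma_finite_measure L by fact
  interpret pair_sigma_finite \<Theta> L ..
  have [measurable]: "p \<in> borel_measurable \<Theta>" and p_int: "integrable \<Theta> p"
    and p0: "\<And>\<omega>. \<omega> \<in> space \<Theta> \<Longrightarrow> 0 \<le> p \<omega>" and p1: "(\<integral>\<omega>. p \<omega> \<partial>\<Theta>) = 1"
    using p by (auto simp: prob_density_def)
  let ?I = "\<lambda>t. \<integral>\<^sup>+\<omega>. ennreal (f \<omega> t * p \<omega>) \<partial>\<Theta>"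
  have "(\<integral>\<^sup>+t. ?I t \<partial>L) = (\<integral>\<^sup>+\<omega>. (\<integral>\<^sup>+t. ennreal (f \<omega> t * p \<omega>) \<partial>L) \<partial>\<Theta>)"
    by (rule Fubini') measurable
  also have "\<dots> = (\<integral>\<^sup>+\<omega>. ennreal (p \<omega>) \<partial>\<Theta>)"
  proof (rule nn_integral_cong)
    fix \<omega> assume \<omega>: "\<omega> \<in> space \<Theta>"
    then have [measurable]: "f \<omega> \<in> borel_measurable L"
      using measurable_Pair2[OF f \<omega>] by simp
    have "(\<integral>\<^sup>+t. ennreal (f \<omega> t * p \<omega>) \<partial>L) = (\<integral>\<^sup>+t. ennreal (f \<omega> t) * ennreal (p \<omega>) \<partial>L)"
      using \<omega> f0 p0 by (intro nn_integral_cong) (simp add: ennreal_mult)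
    also have "\<dots> = ennreal (p \<omega>)"
      using f1[OF \<omega>] by (simp add: nn_integral_multc)
    finally show "(\<integral>\<^sup>+t. ennreal (f \<omega> t * p \<omega>) \<partial>L) = ennreal (p \<omega>)" .
  qed
  also have "\<dots> = 1"
    using p_int p0 p1 by (subst nn_integral_eq_integral) auto
  finally have I1: "(\<integral>\<^sup>+t. ?I t \<partial>L) = 1" .
  have "AE t in L. ?I t \<noteq> \<infinity>"
    using I1 by (intro nn_integral_PInf_AE) auto
  then have *: "AE t in L. integrable \<Theta> (\<lambda>\<omega>. f \<omega> t * p \<omega>) \<and> ennreal (prior_pred \<Theta> f p t) = ?I t"
    using AE_space
  proof eventually_elim
    case (elim t)
    have [measurable]: "(\<lambda>\<omega>. f \<omega> t) \<in> borel_measurable \<Theta>"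
      using measurable_Pair1[OF f] elim by simp
    have "AE \<omega> in \<Theta>. 0 \<le> f \<omega> t * p \<omega>"
      using elim f0 p0 by auto
    moreover from this have "integrable \<Theta> (\<lambda>\<omega>. f \<omega> t * p \<omega>)"
      using elim by (intro integrableI_nonneg) (auto simp: top.not_eq_extremum)
    ultimately show ?case
      by (simp add: prior_pred_def nn_integral_eq_integral)
  qed
  then show "AE t in L. integrable \<Theta> (\<lambda>\<omega>. f \<omega> t * p \<omega>)"
    by eventually_elim simp
  have "(\<integral>\<^sup>+t. ennreal (prior_pred \<Theta> f p t) \<partial>L) = (\<integral>\<^sup>+t. ?I t \<partial>L)"
    by (rule nn_integral_cong_AE, use * in eventually_elim) simp
  with I1 show "(\<integral>\<^sup>+t. ennreal (prior_pred \<Theta> f p t) \<partial>L) = 1" by simp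
qed

lemma nn_integral_distributed_density:
  assumes "prob_space M" "distributed M L T g"
  shows "(\<integral>\<^sup>+t. g t \<partial>L) = 1"
proof -
  have [measurable]: "g \<in> borel_measurable L" "T \<in> measurable M L"
    using assms(2) by (auto simp: distributed_def)
  have "(\<integral>\<^sup>+t. g t \<partial>L) = emeasure (density L g) (space L)"
    by (simp add: emeasure_density nn_integral_set_ennreal cong: nn_integral_cong)
  also have "\<dots> = emeasure (distr M L T) (space L)"
    using assms(2) by (simp add: distributed_def)
  also have "\<dots> = 1"
    using prob_space.emeasure_space_1[OF prob_space.prob_space_distr[OF assms(1), of T L]] by simp
  finally show ?thesis .
qed

section \<open>The contaminated prior and its predictive density\<close>

text \<open>Were the constant 0, division by zero would make the normalized function vanish, with
  integral 0 instead of 1.\<close>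

lemma prob_density_normalized_norm_const:
  "prob_density \<Theta> (normalized \<Theta> q) \<Longrightarrow> norm_const \<Theta> q \<noteq> 0"
  by (auto simp: prob_density_def normalized_def)

lemma norm_const_prior_pred_normalized:
  assumes "norm_const \<Theta> q \<noteq> 0"
  shows "norm_const \<Theta> q * prior_pred \<Theta> f (normalized \<Theta> q) t = (\<integral>\<omega>. f \<omega> t * q \<omega> \<partial>\<Theta>)"
  using assms by (simp add: prior_pred_def normalized_def)

text \<open>The integrands agree pointwise, the weight of \<open>q\<close> cancelling its
  normalization, so no integrability is involved. Where the common denominator is 0, both integrands
  are 0.\<close>

lemma prior_pred_contaminated:
  assumes "norm_const \<Theta> q \<noteq> 0"
  shows "prior_pred \<Theta> f (contaminated_prior \<Theta> \<pi> q \<epsilon>) t =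
    mixture_int \<Theta> (norm_const \<Theta> q) (\<lambda>\<omega>. f \<omega> t * \<pi> \<omega>) (\<lambda>\<omega>. f \<omega> t * q \<omega>) \<epsilon>"
  unfolding prior_pred_def mixture_int_def contaminated_prior_def normalized_def
  using assms by (intro Bochner_Integration.integral_cong refl)
    (simp add: distrib_left add_divide_distrib, simp add: mult.left_commute)

theorem proposition6:
  fixes \<Theta> :: "'p measure" and X :: "'x measure" and L :: "'t measure"
    and P :: "'p \<Rightarrow> 'x measure" and T :: "'x \<Rightarrow> 't"
    and f :: "'p \<Rightarrow> 't \<Rightarrow> real" and \<pi> q :: "'p \<Rightarrow> real" and \<theta> :: 'p
  assumes "sigma_finite_measure \<Theta>" and "sigma_finite_measure L"
    and "\<And>\<omega>. \<omega> \<in> space \<Theta> \<Longrightarrow> prob_space (P \<omega>)"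
    and "\<And>\<omega>. \<omega> \<in> space \<Theta> \<Longrightarrow> sets (P \<omega>) = sets X"
    and "minimal_sufficient_statistic (space \<Theta>) P X L T"
    and "(\<lambda>(\<omega>, t). f \<omega> t) \<in> borel_measurable (\<Theta> \<Otimes>\<^sub>M L)"
    and "\<And>\<omega> t. \<omega> \<in> space \<Theta> \<Longrightarrow> t \<in> space L \<Longrightarrow> 0 \<le> f \<omega> t"
    and "\<And>\<omega>. \<omega> \<in> space \<Theta> \<Longrightarrow> distributed (P \<omega>) L T (\<lambda>t. ennreal (f \<omega> t))"
    and "prob_density \<Theta> \<pi>"
    and "\<theta> \<in> space \<Theta>" and "0 < \<pi> \<theta>"
    and "\<And>\<omega>. \<omega> \<in> space \<Theta> \<Longrightarrow> 0 \<le> q \<omega>" and "integrable \<Theta> q"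
    and "prob_density \<Theta> (normalized \<Theta> q)"
  shows
    "(\<forall>x\<in>space X.
        0 < f \<theta> (T x) \<and> 0 < prior_pred \<Theta> f \<pi> (T x)
        \<and> integrable \<Theta> (\<lambda>\<omega>. f \<omega> (T x) * q \<omega>) \<longrightarrow>
        ((\<lambda>\<epsilon>. ln (rel_belief \<Theta> f (contaminated_prior \<Theta> \<pi> q \<epsilon>) \<theta> (T x)))
          has_real_derivative
          norm_const \<Theta> q * (1 - prior_pred \<Theta> f (normalized \<Theta> q) (T x) / prior_pred \<Theta> f \<pi> (T x)))
        (at 0))
     \<and>
     (absolutely_continuous (prior_pred_measure \<Theta> L f \<pi>)
        (prior_pred_measure \<Theta> L f (normalized \<Theta> q)) \<longrightarrow>
        integrable (prior_pred_measure \<Theta> L f \<pi>)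
          (\<lambda>t. norm_const \<Theta> q * (1 - prior_pred \<Theta> f (normalized \<Theta> q) t / prior_pred \<Theta> f \<pi> t))
        \<and> (\<integral>t. norm_const \<Theta> q * (1 - prior_pred \<Theta> f (normalized \<Theta> q) t / prior_pred \<Theta> f \<pi> t)
              \<partial>prior_pred_measure \<Theta> L f \<pi>) = 0
        \<and> ((AE t in prior_pred_measure \<Theta> L f \<pi>. 0 < f \<theta> t) \<longrightarrow>
            integrable (prior_pred_measure \<Theta> L f \<pi>)
              (\<lambda>t. deriv (\<lambda>\<epsilon>. ln (rel_belief \<Theta> f (contaminated_prior \<Theta> \<pi> q \<epsilon>) \<theta> t)) 0)
            \<and> (\<integral>t. deriv (\<lambda>\<epsilon>. ln (rel_belief \<Theta> f (contaminated_prior \<Theta> \<pi> q \<epsilon>) \<theta> t)) 0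
                  \<partial>prior_pred_measure \<Theta> L f \<pi>) = 0))"
proof -
  let ?c = "norm_const \<Theta> q" and ?q = "normalized \<Theta> q"
  let ?m = "prior_pred \<Theta> f \<pi>" and ?n = "prior_pred \<Theta> f (normalized \<Theta> q)"
  let ?M = "prior_pred_measure \<Theta> L f \<pi>"
  let ?F = "\<lambda>t \<epsilon>. ln (rel_belief \<Theta> f (contaminated_prior \<Theta> \<pi> q \<epsilon>) \<theta> t)"
  let ?g = "\<lambda>t \<omega>. f \<omega> t * \<pi> \<omega>" and ?h = "\<lambda>t \<omega>. f \<omega> t * q \<omega>"
  let ?S = "\<lambda>t. ?c * (1 - ?n t / ?m t)"
  note f_meas [measurable] = assms(6)
  note f0 = assms(7)
  note c = prob_density_normalized_norm_const[OF assms(14)]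
  have \<pi>0: "\<And>\<omega>. \<omega> \<in> space \<Theta> \<Longrightarrow> 0 \<le> \<pi> \<omega>" and [measurable]: "\<pi> \<in> borel_measurable \<Theta>"
    using assms(9) by (auto simp: prob_density_def)
  have q0: "\<And>\<omega>. \<omega> \<in> space \<Theta> \<Longrightarrow> 0 \<le> ?q \<omega>" and [measurable]: "?q \<in> borel_measurable \<Theta>"
    using assms(14) by (auto simp: prob_density_def)
  have F_eq: "?F t = (\<lambda>\<epsilon>. ln (f \<theta> t / mixture_int \<Theta> ?c (?g t) (?h t) \<epsilon>))" for t
    by (simp add: rel_belief_def prior_pred_contaminated[OF c])
  have S_eq: "?S t = ?c - (\<integral>\<omega>. ?h t \<omega> \<partial>\<Theta>) / (\<integral>\<omega>. ?g t \<omega> \<partial>\<Theta>)" for t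
    unfolding norm_const_prior_pred_normalized[OF c, symmetric]
    by (simp add: prior_pred_def right_diff_distrib)
  have h_eq: "?h t = (\<lambda>\<omega>. ?c * (f \<omega> t * ?q \<omega>))" for t
    using c by (auto simp: normalized_def fun_eq_iff)
  have int_h: "integrable \<Theta> (?h t) \<longleftrightarrow> integrable \<Theta> (\<lambda>\<omega>. f \<omega> t * ?q \<omega>)" for t
    unfolding h_eq using c by simp
  \<comment> \<open>A non-integrable function would have Bochner integral 0.\<close>
  have int_g: "integrable \<Theta> (?g t)" if "0 < ?m t" for t
    using that not_integrable_integral_eq by (force simp: prior_pred_def)
  have deriv: "(?F t has_real_derivative ?S t) (at 0)"
    if "0 < f \<theta> t" "0 < ?m t" "integrable \<Theta> (?h t)" for t
    unfolding F_eq S_eq using that int_g[OF that(2)]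
    by (intro has_derivative_ln_mixture) (auto simp: prior_pred_def)
  have m0: "0 \<le> ?m t" and n0: "0 \<le> ?n t" if "t \<in> space L" for t
    using that f0 \<pi>0 q0 by (auto intro!: prior_pred_nonneg)
  note meas [measurable] =
    borel_measurable_prior_pred[OF assms(1) f_meas \<open>\<pi> \<in> borel_measurable \<Theta>\<close>]
    borel_measurable_prior_pred[OF assms(1) f_meas \<open>?q \<in> borel_measurable \<Theta>\<close>]
  have [measurable]: "f \<theta> \<in> borel_measurable L"
    using measurable_Pair2[OF f_meas assms(10)] by simp
  have f1: "(\<integral>\<^sup>+t. ennreal (f \<omega> t) \<partial>L) = 1" if "\<omega> \<in> space \<Theta>" for \<omega>
    using nn_integral_distributed_density[OF assms(3)[OF that] assms(8)[OF that]] .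
  note Fubini_\<pi> = prior_pred_Fubini[OF assms(1,2) f_meas f0 f1 assms(9)]
  note Fubini_q = prior_pred_Fubini[OF assms(1,2) f_meas f0 f1 assms(14)]
  have sets_M [measurable_cong]: "sets ?M = sets L"
    by (simp add: prior_pred_measure_def)
  have T: "T x \<in> space L" if "x \<in> space X" for x
    using assms(5) that
    by (auto simp: minimal_sufficient_statistic_def sufficient_statistic_def measurable_space)

  have expectation: "integrable ?M ?S \<and> (\<integral>t. ?S t \<partial>?M) = 0"
    if "absolutely_continuous ?M (prior_pred_measure \<Theta> L f ?q)"
  proof -
    have "has_bochner_integral ?M (\<lambda>t. ?n t / ?m t) 1"
      using that Fubini_q(1) m0 n0 meas unfolding prior_pred_measure_def
      by (intro has_bochner_integral_density_ratio) auto
    moreover have "prob_space ?M"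
      using Fubini_\<pi>(1)
      by (intro prob_spaceI)
        (simp add: prior_pred_measure_def emeasure_density nn_integral_set_ennreal cong: nn_integral_cong)
    then have "has_bochner_integral ?M (\<lambda>_. 1 :: real) 1"
      by (simp add: has_bochner_integral_iff prob_space.prob_space finite_measure.integrable_const
          prob_space.finite_measure)
    \<comment> \<open>The constant 1 and the density ratio both have expectation 1.\<close>
    ultimately have "has_bochner_integral ?M ?S (?c * (1 - 1))"
      by (intro has_bochner_integral_mult_right has_bochner_integral_diff)
    then show ?thesis by (simp add: has_bochner_integral_iff)
  qed

  have deriv_meas: "(\<lambda>t. deriv (?F t) 0) \<in> borel_measurable ?M"
  proof -
    \<comment> \<open>The closed form of \<open>deriv\<close> is expressed through the prior
      predictives, so that every condition and branch is visibly measurable in \<open>t\<close>;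
      \<open>SOME D. False\<close> is a constant.\<close>
    have "deriv (?F t) 0 =
      (if integrable \<Theta> (?g t) \<and> integrable \<Theta> (\<lambda>\<omega>. f \<omega> t * ?q \<omega>) then
         if 0 < f \<theta> t \<and> 0 < ?m t then ?S t
         else if 0 < f \<theta> t \<and> 0 < ?c * ?n t then (SOME D. False) else 0
       else if ln (f \<theta> t / ?m t) = 0 then 0 else (SOME D. False))" if t: "t \<in> space L" for t
    proof -
      have "0 \<le> f \<theta> t" "0 \<le> (\<integral>\<omega>. ?g t \<omega> \<partial>\<Theta>)" "0 \<le> (\<integral>\<omega>. ?h t \<omega> \<partial>\<Theta>)"
        using f0 \<pi>0 assms(10,12) t by (auto intro!: Bochner_Integration.integral_nonneg)
      from deriv_ln_mixture[OF this, of ?c] show ?thesis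
        unfolding F_eq S_eq norm_const_prior_pred_normalized[OF c] int_h[symmetric]
        by (simp only: prior_pred_def)
    qed
    then have "(\<lambda>t. deriv (?F t) 0) \<in> borel_measurable L"
      by (subst measurable_cong) (assumption, measurable)
    then show ?thesis by (simp add: measurable_cong_sets[OF sets_M refl])
  qed

  have AE_deriv: "AE t in ?M. deriv (?F t) 0 = ?S t" if "AE t in ?M. 0 < f \<theta> t"
  proof -
    \<comment> \<open>The exceptional cases are null: a measure with density \<open>m\<close> gives
      no mass to the zeros of \<open>m\<close>, and Tonelli gives integrability for \<open>q\<close>
      almost everywhere.\<close>
    have "AE t in ?M. 0 < ?m t"
      unfolding prior_pred_measure_def using meas by (subst AE_density) auto
    moreover have "AE t in ?M. integrable \<Theta> (?h t)"
      unfolding prior_pred_measure_def int_h using meas Fubini_q(2) by (subst AE_density) auto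
    ultimately show ?thesis
      using that by eventually_elim (rule DERIV_imp_deriv, rule deriv)
  qed

  have "integrable ?M (\<lambda>t. deriv (?F t) 0) \<and> (\<integral>t. deriv (?F t) 0 \<partial>?M) = 0"
    if ac: "absolutely_continuous ?M (prior_pred_measure \<Theta> L f ?q)" and f: "AE t in ?M. 0 < f \<theta> t"
  proof
    note S = expectation[OF ac]
    then have S_meas: "?S \<in> borel_measurable ?M" by blast
    show "integrable ?M (\<lambda>t. deriv (?F t) 0)"
      using S integrable_cong_AE[OF deriv_meas S_meas AE_deriv[OF f]] by blast
    show "(\<integral>t. deriv (?F t) 0 \<partial>?M) = 0"
      using S integral_cong_AE[OF deriv_meas S_meas AE_deriv[OF f]] by simp
  qed
  with expectation deriv T show ?thesis by blast
qed

end
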